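(* Let $N=\{n!:n\geqslant1\}$ and let $n$ be a positive integer. The maximum of $p_N(\boldsymbol{\lambda})$ over all $N$-partitions $\boldsymbol{\lambda}$ of $n$ is attained at the partition consisting of $\lfloor n/2\rfloor$ parts equal to $2$ and $n-2\lfloor n/2\rfloor$ parts equal to $1$. Moreover, $$\max\{p_N(\boldsymbol{\lambda}):\boldsymbol{\lambda}\text{ an } N\text{-partition of } n\}=2^{\lfloor n/2\rfloor}.$$
   Context: An $N$-partition of $n$ is a partition of $n$ all of whose parts are factorials $k!$ with $k\geqslant1$, and $p_N(n)$ is the number of $N$-partitions of $n$. For an $N$-partition $\boldsymbol{\lambda}=(\lambda_1,\ldots,\lambda_j)$, the extended function is $p_N(\boldsymbol{\lambda})=\prod_{i=1}^j p_N(\lambda_i)$. *)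

theory Defs
  imports Main "HOL-Library.Multiset"
begin

definition N :: "nat set" where
  "N = {fact k | k. k \<ge> 1}"

text \<open>A partition is the multiset of its parts. The parts are positive because
  factorials are.\<close>

definition N_partitions :: "nat \<Rightarrow> nat multiset set" where
  "N_partitions n = {\<Lambda>. set_mset \<Lambda> \<subseteq> N \<and> \<Sum>\<^sub># \<Lambda> = n}"

definition p_N :: "nat \<Rightarrow> nat" where
  "p_N n = card (N_partitions n)"

definition p_N_ext :: "nat multiset \<Rightarrow> nat" where
  "p_N_ext \<Lambda> = (\<Prod>x\<in>#\<Lambda>. p_N x)"

lemma N_pos: "x \<in> N \<Longrightarrow> x \<ge> 1"
  by (auto simp: N_def fact_ge_1)

text \<open>Finiteness, so that \<^const>\<open>card\<close> and \<^const>\<open>Max\<close> have their intended meaning.\<close>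

lemma finite_N_partitions: "finite (N_partitions n)"
proof -
  have "size M \<le> n \<and> set_mset M \<subseteq> {..n}" if "M \<in> N_partitions n" for M
  proof -
    have "size M \<le> \<Sum>\<^sub># M" if "set_mset M \<subseteq> N" for M :: "nat multiset"
      using that by (induction M) (auto dest!: N_pos)
    moreover have "x \<le> \<Sum>\<^sub># M" if "x \<in># M" for x
      using that by (metis le_add1 multi_member_split sum_mset.add_mset)
    ultimately show ?thesis
      using that by (auto simp: N_partitions_def)
  qed
  then have "N_partitions n \<subseteq> mset ` {xs. set xs \<subseteq> {..n} \<and> length xs \<le> n}"
    by (smt (verit) ex_mset image_iff mem_Collect_eq set_mset_mset size_mset subsetI)
  then show ?thesis
    using finite_lists_length_le[of "{..n}" n] finite_subset by blast
qed

end

theory Submission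
  imports Defs
begin

text \<open>Every odd element of \<^const>\<open>N\<close> is 1, so a partition counted by \<open>p_N n\<close> is determined by its
  even parts, which form a multiset of positive even numbers with sum at most \<open>n\<close>. Removing any one
  part shows that there are at most
  \<open>1 + 2 ^ (m - 1) + \<dots> + 2 + 1 = 2 ^ m\<close> of these, where \<open>m = n div 2\<close>. Hence
  \<open>p_N n \<le> 2 ^ (n div 2)\<close>, and the theorem follows because
  \<open>a div 2 + b div 2 \<le> (a + b) div 2\<close>, while \<open>p_N 2 = 2\<close> and \<open>p_N 1 = 1\<close>.\<close>

text \<open>Finiteness is carried through the same induction because bounding \<open>card\<close>
  along an inclusion or an injection requires a finite target.\<close>

lemma card_even_multisets_le:
  "finite {M :: nat multiset. set_mset M \<subseteq> {x. even x \<and> 0 < x} \<and> \<Sum>\<^sub># M \<le> n} \<and>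
   card {M :: nat multiset. set_mset M \<subseteq> {x. even x \<and> 0 < x} \<and> \<Sum>\<^sub># M \<le> n} \<le> 2 ^ (n div 2)"
  (is "finite (?A n) \<and> card (?A n) \<le> _")
proof (induction n rule: less_induct)
  case (less n)
  \<comment> \<open>Here \<open>2 * Suc i\<close> is the removed part. A multiset with several
    distinct parts occurs in several members of the union, which is harmless for an upper
    bound.\<close>
  let ?U = "\<Union>i<n div 2. add_mset (2 * Suc i) ` ?A (n - 2 * Suc i)"
  have sub: "?A n \<subseteq> insert {#} ?U"
  proof
    fix M assume M: "M \<in> ?A n"
    show "M \<in> insert {#} ?U"
    proof (cases M)
      case (add x M')
      then have "even x" "0 < x"
        using M by auto
      then obtain i where i: "x = 2 * Suc i"
        by (metis dvdE gr0_implies_Suc nat_0_less_mult_iff)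
      have "i < n div 2" "M' \<in> ?A (n - 2 * Suc i)"
        using M add i by auto
      then show ?thesis
        using add i by blast
    qed auto
  qed
  have IH: "finite (?A (n - 2 * Suc i))" "card (?A (n - 2 * Suc i)) \<le> 2 ^ (n div 2 - Suc i)"
    if "i < n div 2" for i
  proof -
    have "n - 2 * Suc i < n" "(n - 2 * Suc i) div 2 = n div 2 - Suc i"
      using that by auto
    then show "finite (?A (n - 2 * Suc i))" "card (?A (n - 2 * Suc i)) \<le> 2 ^ (n div 2 - Suc i)"
      using less.IH by metis+
  qed
  have fin: "finite ?U"
    using IH(1) by blast
  have "card ?U \<le> (\<Sum>i<n div 2. card (add_mset (2 * Suc i) ` ?A (n - 2 * Suc i)))"
    by (rule card_UN_le) simp
  also have "\<dots> \<le> (\<Sum>i<n div 2. 2 ^ (n div 2 - Suc i))"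
    using IH by (intro sum_mono) (meson card_image_le le_trans lessThan_iff)
  also have "\<dots> = (\<Sum>i<n div 2. 2 ^ i)"
    by (rule sum.nat_diff_reindex)
  also have "\<dots> = 2 ^ (n div 2) - 1"
    by (simp add: mask_eq_sum_exp_nat lessThan_def)
  \<comment> \<open>The empty multiset makes up for the 1 missing from the geometric sum.\<close>
  finally have "card (insert {#} ?U) \<le> 2 ^ (n div 2)"
    using card_insert_le_m1[of "2 ^ (n div 2)" ?U "{#}"] by simp
  then show ?case
    using sub fin by (meson card_mono finite_insert finite_subset le_trans)
qed

text \<open>2 divides \<open>fact k\<close> as soon as \<open>k\<close> is at least 2.\<close>

lemma odd_in_N: "x \<in> N \<Longrightarrow> odd x \<Longrightarrow> x = 1"
proof -
  assume "x \<in> N" "odd x"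
  then obtain k where k: "x = fact k" "k \<ge> 1"
    by (auto simp: N_def)
  have "\<not> 2 \<le> k"
    using k \<open>odd x\<close> dvd_fact[of 2 k] by auto
  then have "k = 1"
    using k by simp
  then show "x = 1"
    using k by simp
qed

text \<open>All odd parts are 1, so their number is \<open>n\<close> minus the sum of the even
  parts. This gives an explicit left inverse.\<close>

lemma inj_on_even_parts: "inj_on (filter_mset even) (N_partitions n)"
proof -
  have "M = filter_mset even M + replicate_mset (n - \<Sum>\<^sub># (filter_mset even M)) 1"
    if "M \<in> N_partitions n" for M
  proof -
    have "\<forall>x\<in>#filter_mset odd M. x = 1"
      using that odd_in_N by (auto simp: N_partitions_def)
    then obtain c where c: "filter_mset odd M = replicate_mset c 1"
      by (metis set_mset_subset_singletonD singleton_iff subsetI)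
    have M: "M = filter_mset even M + replicate_mset c 1"
      using multiset_partition[of M even] c by simp
    then have "n = \<Sum>\<^sub># (filter_mset even M) + c"
      using that unfolding N_partitions_def
      by (metis (mono_tags, lifting) mem_Collect_eq mult.right_neutral sum_mset.union
          sum_mset_replicate_mset of_nat_id)
    then show ?thesis
      using M by simp
  qed
  then show ?thesis
    by (metis inj_onI)
qed

lemma p_N_le: "p_N n \<le> 2 ^ (n div 2)"
proof -
  let ?A = "{M :: nat multiset. set_mset M \<subseteq> {x. even x \<and> 0 < x} \<and> \<Sum>\<^sub># M \<le> n}"
  have "filter_mset even ` N_partitions n \<subseteq> ?A"
  proof (rule image_subsetI)
    fix M assume M: "M \<in> N_partitions n"
    then have "\<Sum>\<^sub># (filter_mset even M) \<le> n"
      using multiset_partition[of M even]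
      by (metis (mono_tags, lifting) N_partitions_def le_add1 mem_Collect_eq sum_mset.union)
    then show "filter_mset even M \<in> ?A"
      using M N_pos by (fastforce simp: N_partitions_def)
  qed
  then have "p_N n \<le> card ?A"
    unfolding p_N_def
    using card_inj_on_le[OF inj_on_even_parts] card_even_multisets_le by blast
  then show ?thesis
    using card_even_multisets_le[of n] by linarith
qed

lemma p_N_ext_le: "p_N_ext M \<le> 2 ^ (\<Sum>\<^sub># M div 2)"
proof (induction M)
  case (add x M)
  have "p_N_ext (add_mset x M) = p_N x * p_N_ext M"
    by (simp add: p_N_ext_def)
  also have "\<dots> \<le> 2 ^ (x div 2) * 2 ^ (\<Sum>\<^sub># M div 2)"
    using p_N_le add by (rule mult_le_mono)
  also have "\<dots> = 2 ^ (x div 2 + \<Sum>\<^sub># M div 2)"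
    by (simp add: power_add)
  \<comment> \<open>Halving with rounding down is superadditive; it is strictly so only when both
    summands are odd.\<close>
  also have "\<dots> \<le> 2 ^ (\<Sum>\<^sub># (add_mset x M) div 2)"
    by (intro power_increasing) auto
  finally show ?case .
qed (simp add: p_N_ext_def)

lemma one_in_N: "1 \<in> N" and two_in_N: "2 \<in> N"
  unfolding N_def by (force intro: exI[of _ 1], force intro: exI[of _ 2] simp: numeral_2_eq_2)

text \<open>The general bound is \<open>2 ^ 0\<close> here, so exhibiting one partition
  suffices.\<close>

lemma p_N_1: "p_N 1 = 1"
proof -
  have "{#1#} \<in> N_partitions 1"
    using one_in_N by (simp add: N_partitions_def)
  then have "p_N 1 \<noteq> 0"
    using finite_N_partitions by (auto simp: p_N_def)
  then show ?thesis
    using p_N_le[of 1] by simp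
qed

text \<open>Two distinct partitions already meet the general bound \<open>2 ^ 1\<close>.\<close>

lemma p_N_2: "p_N 2 = 2"
proof -
  have "{{#2#}, {#1, 1#}} \<subseteq> N_partitions 2"
    using one_in_N two_in_N by (simp add: N_partitions_def)
  then have "card {{#2#}, {#1, 1 :: nat#}} \<le> p_N 2"
    unfolding p_N_def by (rule card_mono[OF finite_N_partitions])
  then show ?thesis
    using p_N_le[of 2] by simp
qed

theorem theorem6p4:
  fixes n :: nat
  assumes "n \<ge> 1"
  shows "is_arg_max p_N_ext (\<lambda>\<Lambda>. \<Lambda> \<in> N_partitions n)
           (replicate_mset (n div 2) 2 + replicate_mset (n - 2 * (n div 2)) 1)
       \<and> Max (p_N_ext ` N_partitions n) = 2 ^ (n div 2)"
proof -
  let ?L = "replicate_mset (n div 2) 2 + replicate_mset (n - 2 * (n div 2)) (1 :: nat)"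
  have L: "?L \<in> N_partitions n"
    using one_in_N two_in_N by (auto simp: N_partitions_def)
  \<comment> \<open>Each part 2 contributes a factor 2, and a possible part 1 a factor 1.\<close>
  have ext_L: "p_N_ext ?L = 2 ^ (n div 2)"
    using p_N_1 p_N_2 by (simp add: p_N_ext_def)
  have le: "p_N_ext M \<le> 2 ^ (n div 2)" if "M \<in> N_partitions n" for M
    using that p_N_ext_le[of M] by (simp add: N_partitions_def)
  have "is_arg_max p_N_ext (\<lambda>M. M \<in> N_partitions n) ?L"
    unfolding is_arg_max_def using L ext_L le by (simp add: not_less)
  moreover have "Max (p_N_ext ` N_partitions n) = 2 ^ (n div 2)"
    by (rule Max_eqI) (use finite_N_partitions le L ext_L in \<open>auto intro: rev_image_eqI\<close>)
  ultimately show ?thesis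
    by blast
qed

end
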